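(* Consider the dynamic system with sensor selection $\mathbf{x}_{k+1}=\mathbf{F}_k\mathbf{x}_k+\mathbf{w}_k$, $\mathbf{z}_k=\tilde{\mathbf{H}}_k\mathbf{x}_k+\tilde{\mathbf{v}}_k$ described in the context, with arbitrary selection variables $\gamma_{k+1}^1,\ldots,\gamma_{k+1}^L\in\{0,1\}$. Let $\mathbf{x}_{k+1|k+1}$ and $\mathbf{P}_{k+1|k+1}$ be the state estimate and error covariance produced from $\mathbf{x}_{k|k},\mathbf{P}_{k|k},\mathbf{z}_{k+1}$ by the Kalman filter $$\mathbf{x}_{k+1|k+1}=\mathbf{x}_{k+1|k}+\mathbf{K}_{k+1}(\mathbf{z}_{k+1}-\tilde{\mathbf{H}}_{k+1}\mathbf{x}_{k+1|k}),\qquad \mathbf{P}_{k+1|k+1}=(\mathbf{I}-\mathbf{K}_{k+1}\tilde{\mathbf{H}}_{k+1})\mathbf{P}_{k+1|k},$$ where $$\mathbf{x}_{k+1|k}=\mathbf{F}_k\mathbf{x}_{k|k},\quad \mathbf{P}_{k+1|k}=\mathbf{F}_k\mathbf{P}_{k|k}\mathbf{F}_k'+\mathbf{Q}_k,\quad \mathbf{K}_{k+1}=\mathbf{P}_{k+1|k}\tilde{\mathbf{H}}_{k+1}'\bigl(\tilde{\mathbf{H}}_{k+1}\mathbf{P}_{k+1|k}\tilde{\mathbf{H}}_{k+1}'+\tilde{\mathbf{R}}_{k+1}\bigr)^{+}.$$ Then this filter is equivalently given by the generalized information filter $$\mathbf{x}_{k+1|k+1}=\mathbf{P}_{k+1|k+1}\bigl(\mathbf{P}_{k+1|k}^{-1}\mathbf{x}_{k+1|k}+\tilde{\mathbf{H}}_{k+1}'\tilde{\mathbf{R}}_{k+1}^{+}\mathbf{z}_{k+1}\bigr),$$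 $$\mathbf{P}_{k+1|k+1}=\bigl(\mathbf{P}_{k+1|k}^{-1}+\tilde{\mathbf{H}}_{k+1}'\tilde{\mathbf{R}}_{k+1}^{+}\tilde{\mathbf{H}}_{k+1}\bigr)^{-1}.$$
   Context: All matrices are real; prime denotes transpose, and the superscript $+$ denotes the Moore-Penrose generalized inverse. $\mathbf{I}$ is an identity matrix. Setting: $\mathbf{x}_k\in\mathbb{R}^r$, and $\mathbf{F}_k\in\mathbb{R}^{r\times r}$ is invertible. There are $L$ sensors; sensor $i$ has measurement $\mathbf{y}_k^i=\mathbf{H}_k^i\mathbf{x}_k+\mathbf{v}_k^i\in\mathbb{R}^{n_i}$ with $\mathbf{H}_k^i\in\mathbb{R}^{n_i\times r}$. The noises $\mathbf{w}_k$ and $\mathbf{v}_k^i$ are temporally uncorrelated with zero mean; $\mathbf{Q}_k=\mathrm{Cov}(\mathbf{w}_k)$ is invertible (hence symmetric positive definite), and the covariance $\mathbf{R}_k$ of the stacked noise $\mathbf{v}_k=((\mathbf{v}_k^1)',\ldots,(\mathbf{v}_k^L)')'$ is invertible (hence symmetric positive definite). $\mathbf{R}_k$ has blocks $\mathbf{R}_k^{ij}=\mathrm{Cov}(\mathbf{v}_k^i,\mathbf{v}_k^j)$; the noises of different sensors may be correlated. Selection: $\gamma_k^i=1$ if sensor $i$ is selected at time $k$ and $\gamma_k^i=0$ otherwise. The stacked quantities are $\mathbf{z}_k=((\gamma_k^1\mathbf{y}_k^1)',\ldots,(\gamma_k^L\mathbf{y}_k^L)')'$, $\tilde{\mathbf{v}}_k=((\gamma_k^1\mathbf{v}_k^1)',\ldots,(\gamma_k^L\mathbf{v}_k^L)')'$,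 $\tilde{\mathbf{H}}_k=((\gamma_k^1\mathbf{H}_k^1)',\ldots,(\gamma_k^L\mathbf{H}_k^L)')'$, and $\tilde{\mathbf{R}}_k=\mathrm{Cov}(\tilde{\mathbf{v}}_k)$ is the block matrix with blocks $\tilde{\mathbf{R}}_k^{ij}=\gamma_k^i\gamma_k^j\mathbf{R}_k^{ij}$ (in general singular). $\mathbf{P}_{k|k}$ is an error covariance matrix (symmetric positive semidefinite); since $\mathbf{Q}_k$ is positive definite, $\mathbf{P}_{k+1|k}$ is positive definite. *)

theory Defs
  imports
    "HOL-Probability.Probability_Measure"
    "Jordan_Normal_Form.Gauss_Jordan_Elimination"
begin

unbundle no vec_syntax
unbundle no inner_syntax

definition stack_vec :: "nat \<Rightarrow> (nat \<Rightarrow> 'a vec) \<Rightarrow> 'a vec" where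
  "stack_vec L u = vec_of_list (concat (map (\<lambda>i. list_of_vec (u i)) [0..<L]))"

text \<open>The number r of columns is a parameter because it cannot be read off an empty stack.\<close>

definition stack_mat :: "nat \<Rightarrow> nat \<Rightarrow> (nat \<Rightarrow> 'a mat) \<Rightarrow> 'a mat" where
  "stack_mat r L A = mat_of_rows r (concat (map (\<lambda>i. rows (A i)) [0..<L]))"

text \<open>The library inverse is option-valued (\<open>None\<close> for a matrix that is not invertible), so
  \<open>mat_inv A\<close> is meaningful only for invertible \<open>A\<close>.\<close>

definition mat_inv :: "real mat \<Rightarrow> real mat" where
  "mat_inv A = the (mat_inverse A)"

definition is_mp_inverse :: "real mat \<Rightarrow> real mat \<Rightarrow> bool" where
  "is_mp_inverse A X \<longleftrightarrow>
     X \<in> carrier_mat (dim_col A) (dim_row A) \<and>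
     A * X * A = A \<and> X * A * X = X \<and> (A * X)\<^sup>T = A * X \<and> (X * A)\<^sup>T = X * A"

definition mp_inverse :: "real mat \<Rightarrow> real mat" where
  "mp_inverse A = (THE X. is_mp_inverse A X)"

definition sym_psd :: "nat \<Rightarrow> real mat \<Rightarrow> bool" where
  "sym_psd d A \<longleftrightarrow> A \<in> carrier_mat d d \<and> A\<^sup>T = A \<and> (\<forall>u\<in>carrier_vec d. 0 \<le> u \<bullet> (A *\<^sub>v u))"

definition sq_integrable_vec :: "'w measure \<Rightarrow> nat \<Rightarrow> ('w \<Rightarrow> real vec) \<Rightarrow> bool" where
  "sq_integrable_vec M d X \<longleftrightarrow>
     (\<forall>\<omega>\<in>space M. X \<omega> \<in> carrier_vec d) \<and>
     (\<forall>a<d. (\<lambda>\<omega>. X \<omega> $ a) \<in> borel_measurable M \<and> integrable M (\<lambda>\<omega>. (X \<omega> $ a)\<^sup>2))"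

definition mean_vec :: "'w measure \<Rightarrow> nat \<Rightarrow> ('w \<Rightarrow> real vec) \<Rightarrow> real vec" where
  "mean_vec M d X = vec d (\<lambda>a. \<integral>\<omega>. X \<omega> $ a \<partial>M)"

definition cross_cov ::
  "'w measure \<Rightarrow> nat \<Rightarrow> nat \<Rightarrow> ('w \<Rightarrow> real vec) \<Rightarrow> ('w \<Rightarrow> real vec) \<Rightarrow> real mat" where
  "cross_cov M d e X Y = mat d e (\<lambda>(a, b).
     \<integral>\<omega>. (X \<omega> $ a - mean_vec M d X $ a) * (Y \<omega> $ b - mean_vec M e Y $ b) \<partial>M)"

definition Cov :: "'w measure \<Rightarrow> nat \<Rightarrow> ('w \<Rightarrow> real vec) \<Rightarrow> real mat" where
  "Cov M d X = cross_cov M d d X X"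

text \<open>Sensors are numbered \<open>0, \<dots>, L - 1\<close>, and sensor \<open>i\<close> has measurements of dimension \<open>n i\<close>.
  The noises of different sensors at the same time may be correlated, and no relation between
  process and measurement noise is assumed.\<close>

locale sensor_system = prob_space M
  for M :: "'w measure"
    and r L :: nat and n :: "nat \<Rightarrow> nat"
    and F :: "nat \<Rightarrow> real mat" and H :: "nat \<Rightarrow> nat \<Rightarrow> real mat"
    and w :: "nat \<Rightarrow> 'w \<Rightarrow> real vec" and v :: "nat \<Rightarrow> nat \<Rightarrow> 'w \<Rightarrow> real vec"
    and x :: "nat \<Rightarrow> 'w \<Rightarrow> real vec" and y :: "nat \<Rightarrow> nat \<Rightarrow> 'w \<Rightarrow> real vec" +
  assumes F_carrier: "F k \<in> carrier_mat r r"
    and F_invertible: "invertible_mat (F k)"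
    and H_carrier: "i < L \<Longrightarrow> H k i \<in> carrier_mat (n i) r"
    and x_carrier: "\<omega> \<in> space M \<Longrightarrow> x k \<omega> \<in> carrier_vec r"
    and state_eq: "\<omega> \<in> space M \<Longrightarrow> x (Suc k) \<omega> = F k *\<^sub>v x k \<omega> + w k \<omega>"
    and measurement_eq: "\<lbrakk>i < L; \<omega> \<in> space M\<rbrakk> \<Longrightarrow> y k i \<omega> = H k i *\<^sub>v x k \<omega> + v k i \<omega>"
    and w_sq_integrable: "sq_integrable_vec M r (w k)"
    and v_sq_integrable: "i < L \<Longrightarrow> sq_integrable_vec M (n i) (v k i)"
    and w_mean: "mean_vec M r (w k) = 0\<^sub>v r"
    and v_mean: "i < L \<Longrightarrow> mean_vec M (n i) (v k i) = 0\<^sub>v (n i)"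
    and w_uncorrelated: "j \<noteq> k \<Longrightarrow> cross_cov M r r (w j) (w k) = 0\<^sub>m r r"
    and v_uncorrelated: "\<lbrakk>j \<noteq> k; i < L; i' < L\<rbrakk> \<Longrightarrow>
      cross_cov M (n i) (n i') (v j i) (v k i') = 0\<^sub>m (n i) (n i')"
    and Q_invertible: "invertible_mat (Cov M r (w k))"
    and R_invertible: "invertible_mat (Cov M (\<Sum>i<L. n i) (\<lambda>\<omega>. stack_vec L (\<lambda>i. v k i \<omega>)))"

end

theory Submission
  imports Defs "Jordan_Normal_Form.Determinant"
begin

text \<open>Let \<open>D\<close> be the diagonal 0/1 matrix of the selection. Then \<open>G = D H\<close> is the selected observation
  matrix, the selected noise covariance is \<open>D R D\<close>, and the innovation covariance is
  \<open>G P G\<^sup>T + D R D = D (H P H\<^sup>T + R) D\<close>, where \<open>R\<close> and \<open>H P H\<^sup>T + R\<close> are positive definite. Their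
  Moore-Penrose inverses \<open>X\<close> and \<open>Y\<close> therefore behave like inverses relative to the projection \<open>D\<close>:
  \<open>(D R D) X = D = Y (G P G\<^sup>T + D R D)\<close>. Hence \<open>Y (G P G\<^sup>T) X = X - Y\<close>, and with \<open>K = P G\<^sup>T Y\<close> the
  usual computation for the information filter gives \<open>(I - K G) P (G\<^sup>T X) = K\<close> and
  \<open>(I - K G) P (P\<inverse> + G\<^sup>T X G) = I\<close>.\<close>

section \<open>Matrix algebra under dimension equations, and inverses\<close>

text \<open>The side conditions mention only dimensions of the matrices in the conclusion, so
  simplification can discharge them without guessing the carriers of the factors.\<close>

lemma mat_mult_assoc_dim:
  fixes A :: "'a::semiring_0 mat"
  assumes "dim_col A = dim_row B" "dim_col B = dim_row C"
  shows "A * B * C = A * (B * C)"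
  using assms by (intro assoc_mult_mat[of _ "dim_row A" "dim_row B" _ "dim_row C" _ "dim_col C"]) auto

lemma mat_mult_add_dim:
  fixes A :: "'a::ring mat"
  assumes "dim_col A = dim_row B" "dim_row B = dim_row C" "dim_col B = dim_col C"
  shows "A * (B + C) = A * B + A * C"
  using assms by (intro mult_add_distrib_mat[of _ "dim_row A" "dim_row B" _ "dim_col C"]) auto

lemma mat_add_mult_dim:
  fixes A :: "'a::ring mat"
  assumes "dim_row A = dim_row B" "dim_col A = dim_col B" "dim_col B = dim_row C"
  shows "(A + B) * C = A * C + B * C"
  using assms by (intro add_mult_distrib_mat[of _ "dim_row A" "dim_row C" _ _ "dim_col C"]) auto

lemma mat_minus_mult_dim:
  fixes A :: "'a::ring mat"
  assumes "dim_row A = dim_row B" "dim_col A = dim_col B" "dim_col B = dim_row C"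
  shows "(A - B) * C = A * C - B * C"
  using assms by (intro minus_mult_distrib_mat[of _ "dim_row A" "dim_row C" _ _ "dim_col C"]) auto

lemma mat_mult_minus_dim:
  fixes A :: "'a::ring mat"
  assumes "dim_col A = dim_row B" "dim_row B = dim_row C" "dim_col B = dim_col C"
  shows "A * (B - C) = A * B - A * C"
  using assms by (intro mult_minus_distrib_mat[of _ "dim_row A" "dim_row B" _ "dim_col C"]) auto

lemma mat_transpose_mult_dim:
  fixes A :: "'a::comm_semiring_0 mat"
  assumes "dim_col A = dim_row B"
  shows "(A * B)\<^sup>T = B\<^sup>T * A\<^sup>T"
  using assms by (intro transpose_mult[of _ "dim_row A" "dim_row B" _ "dim_col B"]) auto

lemmas mat_ring_dim = mat_mult_assoc_dim mat_mult_add_dim mat_add_mult_dim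
  mat_minus_mult_dim mat_mult_minus_dim

text \<open>A one-sided inverse of a square matrix over a field is two-sided, so
  \<open>mat_inverse\<close> cannot return \<open>None\<close>, and uniqueness of inverses
  identifies its value.\<close>

lemma right_inverse_imp_mat_inv:
  assumes A: "A \<in> carrier_mat d d" and B: "B \<in> carrier_mat d d" and AB: "A * B = 1\<^sub>m d"
  shows "invertible_mat A" "mat_inv A = B"
proof -
  have BA: "B * A = 1\<^sub>m d"
    using mat_mult_left_right_inverse[OF A B AB] .
  show "invertible_mat A"
    using A B AB BA unfolding invertible_mat_def inverts_mat_def by auto
  have "A \<in> Units (ring_mat TYPE(real) d ())"
    using A B AB BA unfolding Units_def ring_mat_def by auto
  then obtain C where C: "mat_inverse A = Some C"
    using mat_inverse(1)[OF A, where b = "()"] by (cases "mat_inverse A") auto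
  from mat_inverse(2)[OF A C]
  have CA: "C * A = 1\<^sub>m d" and Cc: "C \<in> carrier_mat d d" by auto
  have "C = C * (A * B)" using AB Cc by simp
  also have "\<dots> = (C * A) * B" using A B Cc by (simp add: mat_mult_assoc_dim)
  also have "\<dots> = B" using CA B by simp
  finally show "mat_inv A = B" by (simp add: mat_inv_def C)
qed

section \<open>Positive definite and semidefinite matrices\<close>

definition sym_pd :: "nat \<Rightarrow> real mat \<Rightarrow> bool" where
  "sym_pd d A \<longleftrightarrow> A \<in> carrier_mat d d \<and> A\<^sup>T = A \<and>
     (\<forall>u\<in>carrier_vec d. u \<noteq> 0\<^sub>v d \<longrightarrow> 0 < u \<bullet> (A *\<^sub>v u))"

lemma scalar_prod_self_nonneg:
  fixes u :: "real vec"
  shows "0 \<le> u \<bullet> u"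
  by (auto simp: scalar_prod_def intro!: sum_nonneg)

lemma scalar_prod_self_eq_0:
  fixes u :: "real vec"
  assumes "u \<in> carrier_vec d"
  shows "u \<bullet> u = 0 \<longleftrightarrow> u = 0\<^sub>v d"
proof
  assume "u \<bullet> u = 0"
  then have "\<forall>i\<in>{0..<d}. u $ i * u $ i = 0"
    using assms by (subst (asm) scalar_prod_def, subst (asm) sum_nonneg_eq_0_iff) auto
  then show "u = 0\<^sub>v d" using assms by (intro eq_vecI) auto
qed (use assms in \<open>auto simp: scalar_prod_def\<close>)

lemma symmetric_scalar_prod_swap:
  fixes A :: "real mat"
  assumes "A \<in> carrier_mat d d" "A\<^sup>T = A" "u \<in> carrier_vec d" "v \<in> carrier_vec d"
  shows "u \<bullet> (A *\<^sub>v v) = (A *\<^sub>v u) \<bullet> v"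
  using transpose_vec_mult_scalar[of A d d v u] assms by simp

text \<open>A nonzero kernel vector would make the quadratic form vanish, so the determinant is
  nonzero.\<close>

lemma sym_pd_invertible:
  assumes "sym_pd d A"
  obtains B where "B \<in> carrier_mat d d" "A * B = 1\<^sub>m d" "B * A = 1\<^sub>m d"
proof -
  have A: "A \<in> carrier_mat d d"
    and pos: "\<And>u. u \<in> carrier_vec d \<Longrightarrow> u \<noteq> 0\<^sub>v d \<Longrightarrow> 0 < u \<bullet> (A *\<^sub>v u)"
    using assms by (auto simp: sym_pd_def)
  have "det A \<noteq> 0"
  proof
    assume "det A = 0"
    then obtain u where u: "u \<in> carrier_vec d" "u \<noteq> 0\<^sub>v d" "A *\<^sub>v u = 0\<^sub>v d"
      using det_0_iff_vec_prod_zero_field[OF A] by auto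
    then show False using pos[of u] by simp
  qed
  then have "A \<in> Units (ring_mat TYPE(real) d undefined)"
    by (rule det_non_zero_imp_unit[OF A])
  then obtain B where B: "B \<in> carrier_mat d d" and BA: "B * A = 1\<^sub>m d" and AB: "A * B = 1\<^sub>m d"
    unfolding Units_def ring_mat_def by auto
  then show thesis using that by blast
qed

text \<open>A null vector of the quadratic form lies in the kernel: otherwise the form would be negative
  at \<open>u - t A u\<close> for a small \<open>t > 0\<close>.\<close>

lemma sym_psd_invertible_imp_sym_pd:
  assumes psd: "sym_psd d A" and inv: "invertible_mat A"
  shows "sym_pd d A"
proof -
  have A: "A \<in> carrier_mat d d" and AT: "A\<^sup>T = A"
    and nonneg: "\<And>u. u \<in> carrier_vec d \<Longrightarrow> 0 \<le> u \<bullet> (A *\<^sub>v u)"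
    using psd by (auto simp: sym_psd_def)
  obtain B where AB: "A * B = 1\<^sub>m d" and BA': "B * A = 1\<^sub>m (dim_row B)"
    using inv A by (auto simp: invertible_mat_def inverts_mat_def)
  \<comment> \<open>\<open>invertible_mat\<close> leaves the shape of its witness open; comparing
    column counts in the two products recovers it.\<close>
  have "dim_col B = d" using arg_cong[OF AB, of dim_col] by simp
  moreover have "dim_row B = d" using arg_cong[OF BA', of dim_col] A by simp
  ultimately have B: "B \<in> carrier_mat d d" and BA: "B * A = 1\<^sub>m d" using BA' by auto
  have "0 < u \<bullet> (A *\<^sub>v u)" if u: "u \<in> carrier_vec d" and u0: "u \<noteq> 0\<^sub>v d" for u
  proof (rule ccontr)
    assume "\<not> 0 < u \<bullet> (A *\<^sub>v u)"
    then have null: "u \<bullet> (A *\<^sub>v u) = 0" using nonneg[OF u] by simp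
    define e where "e = A *\<^sub>v u"
    define s where "s = e \<bullet> e"
    define c where "c = e \<bullet> (A *\<^sub>v e)"
    have e: "e \<in> carrier_vec d" using A u by (simp add: e_def)
    have Ae: "A *\<^sub>v e \<in> carrier_vec d" using A e by simp
    have c0: "0 \<le> c" using nonneg[OF e] by (simp add: c_def)
    \<comment> \<open>The form at \<open>u - t \<cdot>\<^sub>v e\<close> is
      \<open>t\<^sup>2 * c - 2 * t * s\<close>. This \<open>t\<close> makes it negative unless
      \<open>s = 0\<close>, and the summand 1 keeps the denominator positive when
      \<open>c = 0\<close>.\<close>
    define t where "t = s / (1 + c)"
    have te: "t \<cdot>\<^sub>v e \<in> carrier_vec d" using e by simp
    have uAe: "u \<bullet> (A *\<^sub>v e) = s"
      using symmetric_scalar_prod_swap[OF A AT u e] by (simp add: e_def s_def)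
    have eAu: "e \<bullet> (A *\<^sub>v u) = s" by (simp add: e_def s_def)
    have Atu: "A *\<^sub>v (u - t \<cdot>\<^sub>v e) = A *\<^sub>v u - t \<cdot>\<^sub>v (A *\<^sub>v e)"
      using A u e te by (simp add: mult_minus_distrib_mat_vec mult_mat_vec[OF A e])
    have "(u - t \<cdot>\<^sub>v e) \<bullet> (A *\<^sub>v (u - t \<cdot>\<^sub>v e))
        = u \<bullet> (A *\<^sub>v u) - t * (u \<bullet> (A *\<^sub>v e)) - (t * (e \<bullet> (A *\<^sub>v u)) - t * (t * (e \<bullet> (A *\<^sub>v e))))"
      unfolding Atu using A u e te Ae
      by (simp add: minus_scalar_prod_distrib[of _ d] scalar_prod_minus_distrib[of _ d] algebra_simps)
    also have "\<dots> = - (s\<^sup>2 * (2 + c) / (1 + c)\<^sup>2)"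
      unfolding null uAe eAu c_def[symmetric] t_def using c0
      by (simp add: divide_simps power2_eq_square) (simp add: algebra_simps)
    finally have "s\<^sup>2 * (2 + c) / (1 + c)\<^sup>2 \<le> 0"
      using nonneg[of "u - t \<cdot>\<^sub>v e"] u te by simp
    then have "s = 0" using c0
      by (smt (verit) divide_pos_pos mult_pos_pos zero_less_power2)
    then have "A *\<^sub>v u = 0\<^sub>v d" using scalar_prod_self_eq_0[OF e] by (simp add: s_def e_def)
    then have "B *\<^sub>v (A *\<^sub>v u) = 0\<^sub>v d" using B by auto
    moreover have "B *\<^sub>v (A *\<^sub>v u) = u"
      using assoc_mult_mat_vec[OF B A u] BA u by simp
    ultimately show False using u0 by simp
  qed
  then show ?thesis using A AT by (auto simp: sym_pd_def)
qed

text \<open>The form of \<open>C * A * C\<^sup>T\<close> at \<open>u\<close> is the form of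
  \<open>A\<close> at \<open>C\<^sup>T *\<^sub>v u\<close>.\<close>

lemma sym_psd_congruence:
  assumes "sym_psd d A" and C: "C \<in> carrier_mat e d"
  shows "sym_psd e (C * A * C\<^sup>T)"
proof -
  have A: "A \<in> carrier_mat d d" and AT: "A\<^sup>T = A"
    and nonneg: "\<And>u. u \<in> carrier_vec d \<Longrightarrow> 0 \<le> u \<bullet> (A *\<^sub>v u)"
    using assms by (auto simp: sym_psd_def)
  have "(C * A * C\<^sup>T)\<^sup>T = C * A * C\<^sup>T"
    using A C AT by (simp add: mat_transpose_mult_dim mat_mult_assoc_dim)
  moreover have "0 \<le> u \<bullet> (C * A * C\<^sup>T *\<^sub>v u)" if u: "u \<in> carrier_vec e" for u
  proof -
    have Cu: "C\<^sup>T *\<^sub>v u \<in> carrier_vec d" using C u by simp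
    have "u \<bullet> (C * A * C\<^sup>T *\<^sub>v u) = u \<bullet> (C *\<^sub>v (A *\<^sub>v (C\<^sup>T *\<^sub>v u)))"
      using A C u by (simp add: assoc_mult_mat_vec[of _ e d _ e] assoc_mult_mat_vec[of _ e d _ d])
    also have "\<dots> = (C\<^sup>T *\<^sub>v u) \<bullet> (A *\<^sub>v (C\<^sup>T *\<^sub>v u))"
      using transpose_vec_mult_scalar[OF C _ u, of "A *\<^sub>v (C\<^sup>T *\<^sub>v u)"] A Cu by simp
    finally show ?thesis using nonneg[OF Cu] by simp
  qed
  ultimately show ?thesis using A C by (auto simp: sym_psd_def)
qed

lemma sym_psd_add_sym_pd:
  assumes "sym_psd d A" "sym_pd d B"
  shows "sym_pd d (A + B)"
proof -
  have A: "A \<in> carrier_mat d d" and B: "B \<in> carrier_mat d d"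
    using assms by (auto simp: sym_psd_def sym_pd_def)
  have "u \<bullet> ((A + B) *\<^sub>v u) = u \<bullet> (A *\<^sub>v u) + u \<bullet> (B *\<^sub>v u)" if u: "u \<in> carrier_vec d" for u
    using A B u by (simp add: add_mult_distrib_mat_vec[of _ d d] scalar_prod_add_distrib[of _ d])
  then show ?thesis using assms A B
    by (auto simp: sym_psd_def sym_pd_def transpose_add[of _ d d] intro: add_nonneg_pos)
qed

lemma sym_pd_imp_sym_psd:
  assumes "sym_pd d A"
  shows "sym_psd d A"
proof -
  have A: "A \<in> carrier_mat d d" using assms by (simp add: sym_pd_def)
  have "0 \<le> u \<bullet> (A *\<^sub>v u)" if u: "u \<in> carrier_vec d" for u
  proof (cases "u = 0\<^sub>v d")
    case True
    then show ?thesis using A by simp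
  next
    case False
    then show ?thesis using assms u by (auto simp: sym_pd_def intro: less_imp_le)
  qed
  then show ?thesis using assms by (simp add: sym_pd_def sym_psd_def)
qed

section \<open>Moore-Penrose inverses\<close>

text \<open>Penrose's argument: \<open>A * X\<close> and \<open>A * Y\<close> are both the
  orthogonal projection onto the range of \<open>A\<close>, and \<open>X * A\<close> and
  \<open>Y * A\<close> both project onto its row space; hence
  \<open>X = X * A * X = X * A * Y = Y * A * Y = Y\<close>.\<close>

lemma is_mp_inverse_unique:
  assumes X: "is_mp_inverse A X" and Y: "is_mp_inverse A Y"
  shows "X = Y"
proof -
  let ?m = "dim_row A" and ?n = "dim_col A"
  have A: "A \<in> carrier_mat ?m ?n" by simp
  have Xc: "X \<in> carrier_mat ?n ?m" and Yc: "Y \<in> carrier_mat ?n ?m"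
    using X Y by (auto simp: is_mp_inverse_def)
  have X1: "A * X * A = A" "X * A * X = X" "(A * X)\<^sup>T = A * X" "(X * A)\<^sup>T = X * A"
    and Y1: "A * Y * A = A" "Y * A * Y = Y" "(A * Y)\<^sup>T = A * Y" "(Y * A)\<^sup>T = Y * A"
    using X Y by (auto simp: is_mp_inverse_def)
  \<comment> \<open>Both factors are symmetric, so transposing swaps them, and
    \<open>A * X * A = A\<close> collapses the swapped product to \<open>A * Y\<close>.\<close>
  have "A * X = (A * Y) * (A * X)"
    using A Xc Yc Y1(1) by (simp add: mat_mult_assoc_dim[symmetric])
  also have "\<dots> = ((A * X) * (A * Y))\<^sup>T"
    using Xc Yc X1(3) Y1(3) by (subst mat_transpose_mult_dim) auto
  also have "(A * X) * (A * Y) = A * Y"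
    using A Xc Yc X1(1) by (simp add: mat_mult_assoc_dim[symmetric])
  finally have AX: "A * X = A * Y" using Y1(3) by simp
  have "X * A = (X * A) * (Y * A)"
    using A Xc Yc Y1(1) by (simp add: mat_mult_assoc_dim)
  also have "\<dots> = ((Y * A) * (X * A))\<^sup>T"
    using Xc Yc X1(4) Y1(4) by (subst mat_transpose_mult_dim) auto
  also have "(Y * A) * (X * A) = Y * A"
    using A Xc Yc X1(1) by (simp add: mat_mult_assoc_dim)
  finally have XA: "X * A = Y * A" using Y1(4) by simp
  have "X = X * A * X" using X1(2) by (rule sym)
  also have "\<dots> = X * (A * X)" using Xc by (simp add: mat_mult_assoc_dim)
  also have "\<dots> = X * A * Y" unfolding AX using A Xc Yc by (simp add: mat_mult_assoc_dim)
  also have "\<dots> = Y" unfolding XA using Y1(2) .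
  finally show ?thesis .
qed

lemma mp_inverse_eqI: "is_mp_inverse A X \<Longrightarrow> mp_inverse A = X"
  unfolding mp_inverse_def using is_mp_inverse_unique by blast

text \<open>The compression \<open>D A D\<close> agrees with \<open>C = D A D + (I - D)\<close> on the range of \<open>D\<close>. This \<open>C\<close> is
  positive definite and commutes with \<open>D\<close>, so that \<open>D C\<inverse> D\<close> is the Moore-Penrose inverse.\<close>

lemma mp_inverse_compression:
  assumes pd: "sym_pd N A" and D: "D \<in> carrier_mat N N" and DT: "D\<^sup>T = D" and DD: "D * D = D"
  defines "X \<equiv> mp_inverse (D * A * D)"
  shows "X \<in> carrier_mat N N" "D * A * D * X = D" "X * (D * A * D) = D" "D * X = X" "X * D = X"
proof -
  have A: "A \<in> carrier_mat N N" using pd by (simp add: sym_pd_def)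
  define E where "E = 1\<^sub>m N - D"
  define S where "S = D * A * D"
  define C where "C = S + E"
  have E: "E \<in> carrier_mat N N" unfolding E_def by (rule minus_carrier_mat[OF D])
  have S: "S \<in> carrier_mat N N" using D A by (simp add: S_def)
  have C: "C \<in> carrier_mat N N" using S E by (simp add: C_def)
  have ET: "E\<^sup>T = E" using D DT by (simp add: E_def transpose_minus[of _ N N])
  have EE: "E * E = E" and DE: "D * E = 0\<^sub>m N N" and ED: "E * D = 0\<^sub>m N N"
    using D DD by (auto simp: E_def mat_ring_dim)
  have "D * S = D * D * A * D" "S * D = D * A * (D * D)"
    using A D by (simp_all add: S_def mat_mult_assoc_dim)
  then have DS: "D * S = S" and SD: "S * D = S"
    by (simp_all add: DD S_def)
  have DC: "D * C = S" using D S E DS DE by (simp add: C_def mat_ring_dim)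
  have CD: "C * D = S" using D S E SD ED by (simp add: C_def mat_ring_dim)
  have Spsd: "sym_psd N S"
    using sym_psd_congruence[OF sym_pd_imp_sym_psd[OF pd] D] DT by (simp add: S_def)
  have qE: "u \<bullet> (E *\<^sub>v u) = (E *\<^sub>v u) \<bullet> (E *\<^sub>v u)" if u: "u \<in> carrier_vec N" for u
  proof -
    have "u \<bullet> (E *\<^sub>v u) = u \<bullet> (E *\<^sub>v (E *\<^sub>v u))"
      using assoc_mult_mat_vec[OF E E u] EE by simp
    also have "\<dots> = (E *\<^sub>v u) \<bullet> (E *\<^sub>v u)"
      using symmetric_scalar_prod_swap[OF E ET u, of "E *\<^sub>v u"] E u by simp
    finally show ?thesis .
  qed
  have qS: "u \<bullet> (S *\<^sub>v u) = (D *\<^sub>v u) \<bullet> (A *\<^sub>v (D *\<^sub>v u))" if u: "u \<in> carrier_vec N" for u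
  proof -
    have "u \<bullet> (S *\<^sub>v u) = u \<bullet> (D *\<^sub>v (A *\<^sub>v (D *\<^sub>v u)))"
      using A D u by (simp add: S_def assoc_mult_mat_vec[of _ N N _ N])
    also have "\<dots> = (D *\<^sub>v u) \<bullet> (A *\<^sub>v (D *\<^sub>v u))"
      using symmetric_scalar_prod_swap[OF D DT u, of "A *\<^sub>v (D *\<^sub>v u)"] A D u by simp
    finally show ?thesis .
  qed
  have "sym_pd N C"
    unfolding sym_pd_def
  proof (intro conjI ballI impI)
    show "C \<in> carrier_mat N N" by (rule C)
    show "C\<^sup>T = C" using S E ET Spsd by (simp add: C_def transpose_add[of _ N N] sym_psd_def)
    fix u :: "real vec" assume u: "u \<in> carrier_vec N" and u0: "u \<noteq> 0\<^sub>v N"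
    have Du: "D *\<^sub>v u \<in> carrier_vec N" and Eu: "E *\<^sub>v u \<in> carrier_vec N" using D E u by auto
    \<comment> \<open>The form of \<open>C\<close> is the form of \<open>A\<close> at
      \<open>D *\<^sub>v u\<close> plus the squared length of \<open>E *\<^sub>v u\<close>; if the
      first vector vanishes, the second is \<open>u\<close> itself.\<close>
    have q: "u \<bullet> (C *\<^sub>v u) = (D *\<^sub>v u) \<bullet> (A *\<^sub>v (D *\<^sub>v u)) + (E *\<^sub>v u) \<bullet> (E *\<^sub>v u)"
      using S E u qE[OF u] qS[OF u]
      by (simp add: C_def add_mult_distrib_mat_vec[of _ N N] scalar_prod_add_distrib[of _ N])
    show "0 < u \<bullet> (C *\<^sub>v u)"
    proof (cases "D *\<^sub>v u = 0\<^sub>v N")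
      case True
      then have "E *\<^sub>v u = u" using D u by (simp add: E_def minus_mult_distrib_mat_vec[of _ N N])
      then have "(E *\<^sub>v u) \<bullet> (E *\<^sub>v u) > 0"
        using u u0 scalar_prod_self_eq_0[OF u] scalar_prod_self_nonneg[of u] by simp
      then show ?thesis unfolding q True using A by simp
    next
      case False
      then show ?thesis
        unfolding q using pd Du scalar_prod_self_nonneg[of "E *\<^sub>v u"]
        by (auto simp: sym_pd_def intro!: add_pos_nonneg)
    qed
  qed
  then obtain B where B: "B \<in> carrier_mat N N" and CB: "C * B = 1\<^sub>m N" and BC: "B * C = 1\<^sub>m N"
    using sym_pd_invertible by blast
  \<comment> \<open>\<open>D\<close> commutes with \<open>C\<close>, as both products equal
    \<open>S\<close>; inserting \<open>C * B\<close> and moving \<open>D\<close> across transfers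
    this to the inverse \<open>B\<close>.\<close>
  have "B * D = B * D * (C * B)" using B D CB by simp
  also have "\<dots> = B * (D * C) * B" using B C D by (simp add: mat_mult_assoc_dim)
  also have "\<dots> = B * C * D * B"
    unfolding DC CD[symmetric] using B C D by (simp add: mat_mult_assoc_dim)
  also have "\<dots> = D * B" using BC D by simp
  finally have BD: "B * D = D * B" .
  define Y where "Y = D * B * D"
  have Y: "Y \<in> carrier_mat N N" using B D by (simp add: Y_def)
  \<comment> \<open>Idempotence and commutation absorb either outer factor; the two one-sided forms
    let \<open>C\<close> meet \<open>B\<close> in both products below.\<close>
  have Y': "Y = D * B" "Y = B * D"
  proof -
    have "Y = D * (B * D)" "Y = D * B * D"
      using B D by (simp_all add: Y_def mat_mult_assoc_dim)
    moreover have "D * (D * B) = D * D * B" "B * D * D = B * (D * D)"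
      using B D by (simp_all add: mat_mult_assoc_dim)
    ultimately show "Y = D * B" "Y = B * D" unfolding BD[symmetric] by (simp_all add: BD DD)
  qed
  have DY: "D * Y = Y" unfolding Y' (1) using B D DD by (simp add: mat_mult_assoc_dim[symmetric])
  have YD: "Y * D = Y" unfolding Y' (2) using B D DD by (simp add: mat_mult_assoc_dim)
  have SY: "S * Y = D"
  proof -
    have "S * Y = D * (C * B) * D"
      unfolding DC[symmetric] Y'(2) using B C D by (simp add: mat_mult_assoc_dim)
    then show ?thesis using CB D DD by simp
  qed
  have YS: "Y * S = D"
  proof -
    have "Y * S = D * (B * C) * D"
      unfolding CD[symmetric] Y'(1) using B C D by (simp add: mat_mult_assoc_dim)
    then show ?thesis using BC D DD by simp
  qed
  \<comment> \<open>Both products are the symmetric projection \<open>D\<close>, so the Penrose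
    equations reduce to \<open>D * S = S\<close> and \<open>D * Y = Y\<close>.\<close>
  have "is_mp_inverse S Y"
    unfolding is_mp_inverse_def using S Y SY YS DS DY DT by auto
  then have "X = Y" unfolding X_def S_def[symmetric] by (rule mp_inverse_eqI)
  with Y SY YS DY YD show "X \<in> carrier_mat N N" "D * A * D * X = D" "X * (D * A * D) = D"
    "D * X = X" "X * D = X"
    by (simp_all add: S_def)
qed

section \<open>Algebra of the gain and the information matrix\<close>

text \<open>Both follow from \<open>Y * W * X = X - Y\<close> with
  \<open>W = G * P * G\<^sup>T\<close>, a Woodbury relation for inverses relative to
  \<open>D\<close>. The first rewrites the information gain as \<open>K\<close>; the second makes
  the updated covariance a left inverse of the information matrix.\<close>

lemma kalman_information_identities:
  fixes P :: "real mat"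
  assumes P: "P \<in> carrier_mat r r" and Pinv: "Pinv \<in> carrier_mat r r" and PPinv: "P * Pinv = 1\<^sub>m r"
    and G: "G \<in> carrier_mat N r" and R: "R \<in> carrier_mat N N"
    and X: "X \<in> carrier_mat N N" and Y: "Y \<in> carrier_mat N N"
    and RX: "R * X = D" and YS: "Y * (G * P * G\<^sup>T + R) = D"
    and YD: "Y * D = Y" and DX: "D * X = X"
  defines "K \<equiv> P * G\<^sup>T * Y"
  shows "(1\<^sub>m r - K * G) * P * (G\<^sup>T * X) = K"
    and "(1\<^sub>m r - K * G) * P * (Pinv + G\<^sup>T * X * G) = 1\<^sub>m r"
proof -
  define W where "W = G * P * G\<^sup>T"
  define T where "T = P * G\<^sup>T"
  have W: "W \<in> carrier_mat N N" and T: "T \<in> carrier_mat r N"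
    using P G by (auto simp: W_def T_def)
  have K: "K \<in> carrier_mat r N" using T Y by (simp add: K_def T_def[symmetric])
  \<comment> \<open>Since \<open>D * X = X\<close>, the product \<open>Y * (W + R) = D\<close> may
    be put in front of \<open>X\<close>; the term with \<open>R\<close> then becomes
    \<open>Y * D = Y\<close>.\<close>
  have "X = Y * (W + R) * X" using YS DX by (simp add: W_def)
  also have "\<dots> = Y * W * X + Y * (R * X)"
    using W R X Y by (simp add: mat_ring_dim)
  also have "\<dots> = Y * W * X + Y" by (simp add: RX YD)
  finally have "X - Y = (Y * W * X + Y) - Y" by simp
  also have "\<dots> = Y * W * X" using W X Y by (intro eq_matI) auto
  finally have YWX: "Y * W * X = X - Y" by simp
  have KGTX: "K * G * (T * X) = T * X - K"
  proof -
    have "K * G * (T * X) = T * (Y * W * X)"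
      using P G X Y by (simp add: K_def T_def W_def mat_mult_assoc_dim)
    also have "\<dots> = T * X - K"
      unfolding YWX using T X Y by (simp add: mat_ring_dim K_def T_def[symmetric])
    finally show ?thesis .
  qed
  have gain: "(1\<^sub>m r - K * G) * (T * X) = K"
  proof -
    have "(1\<^sub>m r - K * G) * (T * X) = T * X - K * G * (T * X)"
      using K G T X by (simp add: mat_minus_mult_dim)
    then show ?thesis unfolding KGTX using T X K by (intro eq_matI) auto
  qed
  have "(1\<^sub>m r - K * G) * P * (G\<^sup>T * X) = (1\<^sub>m r - K * G) * (T * X)"
    using K G P X by (simp add: T_def mat_mult_assoc_dim)
  then show g: "(1\<^sub>m r - K * G) * P * (G\<^sup>T * X) = K" using gain by simp
  have J: "1\<^sub>m r - K * G \<in> carrier_mat r r" by (rule minus_carrier_mat[OF mult_carrier_mat[OF K G]])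
  \<comment> \<open>Cancelling \<open>P * Pinv\<close> leaves \<open>1\<^sub>m r - K * G\<close>;
    the first identity turns the remaining term into \<open>K * G\<close>.\<close>
  have "(1\<^sub>m r - K * G) * P * (Pinv + G\<^sup>T * X * G)
      = (1\<^sub>m r - K * G) * (P * Pinv) + (1\<^sub>m r - K * G) * P * (G\<^sup>T * X) * G"
    using J P Pinv G X by (simp add: mat_mult_assoc_dim mat_mult_add_dim)
  also have "\<dots> = (1\<^sub>m r - K * G) + K * G" unfolding g PPinv by (simp only: right_mult_one_mat[OF J])
  also have "\<dots> = 1\<^sub>m r" using K G by (intro eq_matI) auto
  finally show "(1\<^sub>m r - K * G) * P * (Pinv + G\<^sup>T * X * G) = 1\<^sub>m r" .
qed

section \<open>Stacked vectors and matrices by index\<close>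

text \<open>Position \<open>a\<close> of a stacked vector holds component \<open>b\<close> of block \<open>i\<close>, where \<open>(i, b)\<close> is the entry
  at position \<open>a\<close> of \<open>stack_index L n\<close>.\<close>

definition stack_index :: "nat \<Rightarrow> (nat \<Rightarrow> nat) \<Rightarrow> (nat \<times> nat) list" where
  "stack_index L n = concat (map (\<lambda>i. map (Pair i) [0..<n i]) [0..<L])"

lemma length_stack_index: "length (stack_index L n) = (\<Sum>i<L. n i)"
  by (induction L) (auto simp: stack_index_def)

lemma stack_index_nth:
  assumes "a < (\<Sum>i<L. n i)" "stack_index L n ! a = (i, b)"
  shows "i < L" "b < n i"
proof -
  have "(i, b) \<in> set (stack_index L n)"
    using assms length_stack_index[of L n] by (metis nth_mem)
  then show "i < L" "b < n i" by (auto simp: stack_index_def)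
qed

lemma concat_blocks_stack_index:
  assumes "\<And>i. i < L \<Longrightarrow> f i = map (g i) [0..<n i]"
  shows "concat (map f [0..<L]) = map (\<lambda>(i, b). g i b) (stack_index L n)"
proof -
  have blocks: "map f [0..<L] = map (\<lambda>i. map (g i) [0..<n i]) [0..<L]" using assms by simp
  show ?thesis unfolding blocks by (simp add: stack_index_def map_concat comp_def)
qed

text \<open>In indexed form, scaling block \<open>i\<close> by its selection variable becomes
  scaling each component \<open>a\<close>, that is, a diagonal multiplication.\<close>

lemma stack_vec_conv_stack_index:
  assumes "\<And>i. i < L \<Longrightarrow> u i \<in> carrier_vec (n i)"
  shows "stack_vec L u = vec (\<Sum>i<L. n i) (\<lambda>a. case stack_index L n ! a of (i, b) \<Rightarrow> u i $ b)"
proof -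
  have "concat (map (\<lambda>i. list_of_vec (u i)) [0..<L])
      = map (\<lambda>(i, b). u i $ b) (stack_index L n)"
    by (intro concat_blocks_stack_index) (simp add: list_of_vec_map carrier_vecD[OF assms])
  then show ?thesis
    unfolding stack_vec_def
    by (intro eq_vecI) (auto simp: vec_of_list_index length_stack_index split: prod.splits)
qed

lemma stack_mat_conv_stack_index:
  assumes "\<And>i. i < L \<Longrightarrow> A i \<in> carrier_mat (n i) r"
  shows "stack_mat r L A
    = mat (\<Sum>i<L. n i) r (\<lambda>(a, j). case stack_index L n ! a of (i, b) \<Rightarrow> A i $$ (b, j))"
proof -
  have "concat (map (\<lambda>i. rows (A i)) [0..<L]) = map (\<lambda>(i, b). row (A i) b) (stack_index L n)"
    by (intro concat_blocks_stack_index) (simp add: rows_def carrier_matD(1)[OF assms])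
  then have "stack_mat r L A = mat_of_rows r (map (\<lambda>(i, b). row (A i) b) (stack_index L n))"
    by (simp add: stack_mat_def)
  moreover have "row (A i) b $ j = A i $$ (b, j)"
    if "a < (\<Sum>i<L. n i)" "stack_index L n ! a = (i, b)" "j < r" for a i b j
    using stack_index_nth[OF that(1,2)] assms[of i] that(3) by auto
  ultimately show ?thesis
    by (intro eq_matI) (auto simp: mat_of_rows_index length_stack_index split: prod.splits)
qed

section \<open>Covariances of stacked and scaled vectors\<close>

lemma sq_integrable_stack_vec:
  assumes v: "\<And>i. i < L \<Longrightarrow> sq_integrable_vec M (n i) (v i)"
  shows "sq_integrable_vec M (\<Sum>i<L. n i) (\<lambda>\<omega>. stack_vec L (\<lambda>i. v i \<omega>))"
proof -
  have c: "stack_vec L (\<lambda>i. v i \<omega>)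
      = vec (\<Sum>i<L. n i) (\<lambda>a. case stack_index L n ! a of (i, b) \<Rightarrow> v i \<omega> $ b)"
    if "\<omega> \<in> space M" for \<omega>
    using v that by (intro stack_vec_conv_stack_index) (auto simp: sq_integrable_vec_def)
  show ?thesis
    unfolding sq_integrable_vec_def
  proof (intro conjI ballI allI impI)
    fix \<omega> assume "\<omega> \<in> space M"
    then show "stack_vec L (\<lambda>i. v i \<omega>) \<in> carrier_vec (\<Sum>i<L. n i)" by (simp add: c)
  next
    fix a assume a: "a < (\<Sum>i<L. n i)"
    obtain i b where ib: "stack_index L n ! a = (i, b)" by force
    have e: "stack_vec L (\<lambda>i. v i \<omega>) $ a = v i \<omega> $ b" if "\<omega> \<in> space M" for \<omega>
      using a ib that by (simp add: c)
    note i = stack_index_nth[OF a ib]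
    show "(\<lambda>\<omega>. stack_vec L (\<lambda>i. v i \<omega>) $ a) \<in> borel_measurable M"
      using v[OF i(1)] i(2) by (subst measurable_cong[OF e]) (auto simp: sq_integrable_vec_def)
    show "integrable M (\<lambda>\<omega>. (stack_vec L (\<lambda>i. v i \<omega>) $ a)\<^sup>2)"
      using v[OF i(1)] i(2)
      by (subst Bochner_Integration.integrable_cong[OF refl, where g = "\<lambda>\<omega>. (v i \<omega> $ b)\<^sup>2"])
        (auto simp: sq_integrable_vec_def e)
  qed
qed

text \<open>The product is dominated by
  \<open>(f \<omega>)\<^sup>2 + (g \<omega>)\<^sup>2\<close>.\<close>

lemma (in prob_space) integrable_mult_of_sq_integrable:
  fixes f g :: "'a \<Rightarrow> real"
  assumes [measurable]: "f \<in> borel_measurable M" "g \<in> borel_measurable M"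
    and "integrable M (\<lambda>\<omega>. (f \<omega>)\<^sup>2)" "integrable M (\<lambda>\<omega>. (g \<omega>)\<^sup>2)"
  shows "integrable M (\<lambda>\<omega>. f \<omega> * g \<omega>)"
proof (rule Bochner_Integration.integrable_bound)
  show "integrable M (\<lambda>\<omega>. (f \<omega>)\<^sup>2 + (g \<omega>)\<^sup>2)" using assms by simp
  have "\<bar>a * b\<bar> \<le> a\<^sup>2 + b\<^sup>2" for a b :: real
  proof -
    have "2 * \<bar>a * b\<bar> \<le> a\<^sup>2 + b\<^sup>2"
      using sum_squares_bound[of "\<bar>a\<bar>" "\<bar>b\<bar>"] by (simp add: abs_mult mult.assoc)
    then show ?thesis by linarith
  qed
  then show "AE \<omega> in M. norm (f \<omega> * g \<omega>) \<le> norm ((f \<omega>)\<^sup>2 + (g \<omega>)\<^sup>2)" by simp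
qed simp

text \<open>The quadratic form at \<open>u\<close> is the expected square of the centred linear form
  with coefficients \<open>u\<close>.\<close>

lemma (in prob_space) sym_psd_Cov:
  assumes X: "sq_integrable_vec M d X"
  shows "sym_psd d (Cov M d X)"
proof -
  define f where "f a \<omega> = X \<omega> $ a - mean_vec M d X $ a" for a \<omega>
  have meas: "f a \<in> borel_measurable M" and sq: "integrable M (\<lambda>\<omega>. (f a \<omega>)\<^sup>2)"
    if a: "a < d" for a
  proof -
    have m [measurable]: "(\<lambda>\<omega>. X \<omega> $ a) \<in> borel_measurable M"
      and s: "integrable M (\<lambda>\<omega>. (X \<omega> $ a)\<^sup>2)"
      using X a by (auto simp: sq_integrable_vec_def)
    show "f a \<in> borel_measurable M" unfolding f_def by measurable
    \<comment> \<open>Constants are square integrable on a probability space, so taking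
      \<open>g = 1\<close> gives the first moment needed to expand the centred square.\<close>
    have "integrable M (\<lambda>\<omega>. X \<omega> $ a)"
      using integrable_mult_of_sq_integrable[OF m _ s, of "\<lambda>_. 1"] by simp
    then show "integrable M (\<lambda>\<omega>. (f a \<omega>)\<^sup>2)"
      using s unfolding f_def power2_diff by (auto simp: mult.assoc)
  qed
  have int: "integrable M (\<lambda>\<omega>. f a \<omega> * f b \<omega>)" if "a < d" "b < d" for a b
    using that by (intro integrable_mult_of_sq_integrable meas sq)
  have C: "Cov M d X = mat d d (\<lambda>(a, b). \<integral>\<omega>. f a \<omega> * f b \<omega> \<partial>M)"
    by (simp add: Cov_def cross_cov_def f_def)
  have "0 \<le> u \<bullet> (Cov M d X *\<^sub>v u)" if u: "u \<in> carrier_vec d" for u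
  proof -
    have int': "integrable M (\<lambda>\<omega>. (u $ a * f a \<omega>) * (u $ b * f b \<omega>))" if "a < d" "b < d" for a b
      using integrable_mult_right[OF int[OF that], of "u $ a * u $ b"] by (simp add: mult_ac)
    have "u \<bullet> (Cov M d X *\<^sub>v u)
        = (\<Sum>a<d. \<Sum>b<d. \<integral>\<omega>. (u $ a * f a \<omega>) * (u $ b * f b \<omega>) \<partial>M)"
      using u by (simp add: C scalar_prod_def sum_distrib_left lessThan_atLeast0 mult_ac
          flip: integral_mult_right_zero)
    also have "\<dots> = (\<integral>\<omega>. (\<Sum>a<d. \<Sum>b<d. (u $ a * f a \<omega>) * (u $ b * f b \<omega>)) \<partial>M)"
      by (subst Bochner_Integration.integral_sum)
        (auto intro!: sum.cong Bochner_Integration.integrable_sum int'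
          Bochner_Integration.integral_sum[symmetric])
    also have "\<dots> = (\<integral>\<omega>. (\<Sum>a<d. u $ a * f a \<omega>)\<^sup>2 \<partial>M)"
      by (simp add: power2_eq_square sum_product)
    also have "\<dots> \<ge> 0" by (intro Bochner_Integration.integral_nonneg) simp
    finally show ?thesis .
  qed
  moreover have "(Cov M d X)\<^sup>T = Cov M d X"
    unfolding C by (intro eq_matI) (auto simp: mult.commute)
  ultimately show ?thesis by (simp add: sym_psd_def C)
qed

text \<open>The factors pass through the mean and leave each covariance entry as
  \<open>c a * c b\<close>. With selection variables for \<open>c\<close>, this is the passage from
  \<open>R\<close> to \<open>D * R * D\<close>.\<close>

lemma Cov_scaled_components:
  assumes "\<And>\<omega> a. \<omega> \<in> space M \<Longrightarrow> a < d \<Longrightarrow> Y \<omega> $ a = c a * X \<omega> $ a"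
  shows "Cov M d Y = mat_diag d c * Cov M d X * mat_diag d c"
proof -
  have m: "mean_vec M d Y $ a = c a * mean_vec M d X $ a" if "a < d" for a
  proof -
    have "(\<integral>\<omega>. Y \<omega> $ a \<partial>M) = (\<integral>\<omega>. c a * X \<omega> $ a \<partial>M)"
      using assms that by (intro Bochner_Integration.integral_cong) auto
    then show ?thesis using that by (simp add: mean_vec_def)
  qed
  have "(\<integral>\<omega>. (Y \<omega> $ a - mean_vec M d Y $ a) * (Y \<omega> $ b - mean_vec M d Y $ b) \<partial>M)
      = (\<integral>\<omega>. (c a * c b) * ((X \<omega> $ a - mean_vec M d X $ a) * (X \<omega> $ b - mean_vec M d X $ b)) \<partial>M)"
    if "a < d" "b < d" for a b
    using that by (intro Bochner_Integration.integral_cong refl) (simp add: assms m algebra_simps)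
  then have "(\<integral>\<omega>. (Y \<omega> $ a - mean_vec M d Y $ a) * (Y \<omega> $ b - mean_vec M d Y $ b) \<partial>M)
      = c a * c b * (\<integral>\<omega>. (X \<omega> $ a - mean_vec M d X $ a) * (X \<omega> $ b - mean_vec M d X $ b) \<partial>M)"
    if "a < d" "b < d" for a b
    using that by simp
  then show ?thesis
    unfolding Cov_def cross_cov_def
    by (subst mat_diag_mult_left[of _ d d], simp, subst mat_diag_mult_right[of _ d d], simp)
      (auto intro!: eq_matI)
qed

section \<open>Equivalence of the two filters\<close>

theorem theorem2p1:
  fixes M :: "'w measure" and r L k :: nat and n :: "nat \<Rightarrow> nat"
    and F :: "nat \<Rightarrow> real mat" and H :: "nat \<Rightarrow> nat \<Rightarrow> real mat"
    and w x :: "nat \<Rightarrow> 'w \<Rightarrow> real vec" and v y :: "nat \<Rightarrow> nat \<Rightarrow> 'w \<Rightarrow> real vec"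
    and \<gamma> :: "nat \<Rightarrow> nat \<Rightarrow> real"
    and Ht :: "nat \<Rightarrow> real mat" and z vt :: "nat \<Rightarrow> 'w \<Rightarrow> real vec"
    and Rt :: "nat \<Rightarrow> real mat" and \<omega> :: 'w
    and x_kk x_pred x_new :: "real vec" and P_kk P_pred P_new K :: "real mat"
  assumes sys: "sensor_system M r L n F H w v x y"
    and gamma: "\<And>j i. i < L \<Longrightarrow> \<gamma> j i \<in> {0, 1}"
    and z_eq: "\<And>j \<omega>. z j \<omega> = stack_vec L (\<lambda>i. \<gamma> j i \<cdot>\<^sub>v y j i \<omega>)"
    and vt_eq: "\<And>j \<omega>. vt j \<omega> = stack_vec L (\<lambda>i. \<gamma> j i \<cdot>\<^sub>v v j i \<omega>)"
    and Ht_eq: "\<And>j. Ht j = stack_mat r L (\<lambda>i. \<gamma> j i \<cdot>\<^sub>m H j i)"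
    and Rt_eq: "\<And>j. Rt j = Cov M (\<Sum>i<L. n i) (vt j)"
    and omega: "\<omega> \<in> space M"
    and x_kk: "x_kk \<in> carrier_vec r"
    and P_kk: "sym_psd r P_kk"
    and x_pred: "x_pred = F k *\<^sub>v x_kk"
    and P_pred: "P_pred = F k * P_kk * (F k)\<^sup>T + Cov M r (w k)"
    and K: "K = P_pred * (Ht (k+1))\<^sup>T *
              mp_inverse (Ht (k+1) * P_pred * (Ht (k+1))\<^sup>T + Rt (k+1))"
  shows "invertible_mat P_pred \<and>
    invertible_mat (mat_inv P_pred + (Ht (k+1))\<^sup>T * mp_inverse (Rt (k+1)) * Ht (k+1)) \<and>
    ((x_new = x_pred + K *\<^sub>v (z (k+1) \<omega> - Ht (k+1) *\<^sub>v x_pred) \<and>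
      P_new = (1\<^sub>m r - K * Ht (k+1)) * P_pred)
     \<longleftrightarrow>
     (x_new = P_new *\<^sub>v (mat_inv P_pred *\<^sub>v x_pred
                + ((Ht (k+1))\<^sup>T * mp_inverse (Rt (k+1))) *\<^sub>v z (k+1) \<omega>) \<and>
      P_new = mat_inv (mat_inv P_pred + (Ht (k+1))\<^sup>T * mp_inverse (Rt (k+1)) * Ht (k+1))))"
proof -
  interpret sensor_system M r L n F H w v x y by (rule sys)
  define N where "N = (\<Sum>i<L. n i)"
  \<comment> \<open>\<open>c a\<close> is the selection variable of the sensor that owns coordinate
    \<open>a\<close> of the stack.\<close>
  define c where "c a = \<gamma> (k+1) (fst (stack_index L n ! a))" for a
  define D where "D = mat_diag N c"
  define Hs where "Hs = stack_mat r L (H (k+1))"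
  define R where "R = Cov M N (\<lambda>\<omega>. stack_vec L (\<lambda>i. v (k+1) i \<omega>))"
  define G where "G = Ht (k+1)"
  define zz where "zz = z (k+1) \<omega>"
  have c01: "c a \<in> {0, 1}" if "a < N" for a
    using gamma[OF stack_index_nth(1)[of a n L _ "snd (stack_index L n ! a)"], of _ "k+1"] that
    by (simp add: c_def N_def)
  have D: "D \<in> carrier_mat N N" and DT: "D\<^sup>T = D"
    by (auto simp: D_def mat_diag_def)
  \<comment> \<open>The values 0 and 1 are their own squares, so the diagonal matrix is
    idempotent.\<close>
  have DD: "D * D = D"
    using c01 by (auto simp: D_def) (auto simp: mat_diag_def intro!: eq_matI)

  have Hs: "Hs \<in> carrier_mat N r"
    unfolding Hs_def by (subst stack_mat_conv_stack_index[where n = n]) (auto simp: H_carrier N_def)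
  have G_eq: "G = D * Hs"
  proof -
    have "G = mat N r (\<lambda>(a, j). case stack_index L n ! a of
        (i, b) \<Rightarrow> (\<gamma> (k+1) i \<cdot>\<^sub>m H (k+1) i) $$ (b, j))"
      unfolding G_def Ht_eq N_def
      by (intro stack_mat_conv_stack_index) (use H_carrier in auto)
    moreover have "Hs = mat N r (\<lambda>(a, j). case stack_index L n ! a of (i, b) \<Rightarrow> H (k+1) i $$ (b, j))"
      unfolding Hs_def N_def by (intro stack_mat_conv_stack_index) (use H_carrier in auto)
    moreover have "(\<gamma> (k+1) i \<cdot>\<^sub>m H (k+1) i) $$ (b, j) = c a * H (k+1) i $$ (b, j)"
      if "a < N" "j < r" "stack_index L n ! a = (i, b)" for a i b j
      using stack_index_nth[of a n L i b] that H_carrier[of i "k+1"] by (auto simp: c_def N_def)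
    ultimately show ?thesis
      unfolding D_def by (subst mat_diag_mult_left[OF Hs]) (auto intro!: eq_matI split: prod.splits)
  qed
  have G: "G \<in> carrier_mat N r" using D Hs by (simp add: G_eq)

  have v_carrier: "v j i \<omega>' \<in> carrier_vec (n i)" if "i < L" "\<omega>' \<in> space M" for j i \<omega>'
    using v_sq_integrable[OF that(1)] that(2) by (auto simp: sq_integrable_vec_def)
  have Rt: "Rt (k+1) = D * R * D"
    unfolding Rt_eq R_def D_def N_def[symmetric]
  proof (rule Cov_scaled_components)
    fix \<omega>' a assume \<omega>': "\<omega>' \<in> space M" and a: "a < N"
    obtain i b where ib: "stack_index L n ! a = (i, b)" by force
    note i = stack_index_nth[OF a[unfolded N_def] ib]
    have "vt (k+1) \<omega>' = vec N (\<lambda>a. case stack_index L n ! a of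
        (i, b) \<Rightarrow> (\<gamma> (k+1) i \<cdot>\<^sub>v v (k+1) i \<omega>') $ b)"
      unfolding vt_eq N_def by (intro stack_vec_conv_stack_index) (use v_carrier \<omega>' in auto)
    moreover have "stack_vec L (\<lambda>i. v (k+1) i \<omega>')
        = vec N (\<lambda>a. case stack_index L n ! a of (i, b) \<Rightarrow> v (k+1) i \<omega>' $ b)"
      unfolding N_def by (intro stack_vec_conv_stack_index) (use v_carrier \<omega>' in auto)
    ultimately show "vt (k+1) \<omega>' $ a = c a * stack_vec L (\<lambda>i. v (k+1) i \<omega>') $ a"
      using a ib i v_carrier[OF i(1) \<omega>', of "k+1"] by (auto simp: c_def)
  qed
  have zz: "zz \<in> carrier_vec N"
  proof -
    \<comment> \<open>A sum of vectors has the dimension of its second summand, so the noise in the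
      measurement equation fixes the block sizes.\<close>
    have "dim_vec (y (k+1) i \<omega>) = n i" if "i < L" for i
      using measurement_eq[OF that omega, of "k+1"] v_carrier[OF that omega, of "k+1"] by simp
    then have "zz = vec N (\<lambda>a. case stack_index L n ! a of
        (i, b) \<Rightarrow> (\<gamma> (k+1) i \<cdot>\<^sub>v y (k+1) i \<omega>) $ b)"
      unfolding zz_def z_eq N_def by (intro stack_vec_conv_stack_index) (auto intro!: carrier_vecI)
    then show ?thesis by simp
  qed

  \<comment> \<open>Covariances are semidefinite in general; the assumed invertibility makes
    \<open>R\<close> definite, and likewise the process noise term makes \<open>P_pred\<close>
    definite.\<close>
  have Rpd: "sym_pd N R"
    unfolding R_def N_def
    by (intro sym_psd_invertible_imp_sym_pd sym_psd_Cov sq_integrable_stack_vec v_sq_integrable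
        R_invertible)
  have Ppd: "sym_pd r P_pred"
    unfolding P_pred
    by (intro sym_psd_add_sym_pd sym_psd_congruence[OF P_kk] F_carrier
        sym_psd_invertible_imp_sym_pd sym_psd_Cov w_sq_integrable Q_invertible)
  have P: "P_pred \<in> carrier_mat r r" and Rc: "R \<in> carrier_mat N N"
    using Ppd Rpd by (auto simp: sym_pd_def)
  obtain Pinv where Pinv: "Pinv \<in> carrier_mat r r" and PPinv: "P_pred * Pinv = 1\<^sub>m r"
    using sym_pd_invertible[OF Ppd] by blast
  note P_inv = right_inverse_imp_mat_inv[OF P Pinv PPinv]

  define B where "B = Hs * P_pred * Hs\<^sup>T + R"
  have Bpd: "sym_pd N B"
    unfolding B_def
    by (intro sym_psd_add_sym_pd Rpd sym_psd_congruence[OF sym_pd_imp_sym_psd[OF Ppd]] Hs)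
  \<comment> \<open>Symmetry of \<open>D\<close> lets the observation and noise terms share the
    outer factors, so the innovation covariance is a compression of the definite matrix
    \<open>B\<close>.\<close>
  have S_eq: "G * P_pred * G\<^sup>T + D * R * D = D * B * D"
    using D Hs P Rc DT by (simp add: G_eq B_def mat_transpose_mult_dim mat_ring_dim)
  define X where "X = mp_inverse (D * R * D)"
  define Y where "Y = mp_inverse (D * B * D)"
  note Xp = mp_inverse_compression[OF Rpd D DT DD, folded X_def]
  note Yp = mp_inverse_compression[OF Bpd D DT DD, folded Y_def]
  have K': "K = P_pred * G\<^sup>T * Y"
    unfolding K Rt G_def[symmetric] S_eq Y_def ..
  have Kc: "K \<in> carrier_mat r N" using P G Yp(1) by (simp add: K')
  define Pn where "Pn = (1\<^sub>m r - K * G) * P_pred"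
  define J where "J = Pinv + G\<^sup>T * X * G"
  have Pn: "Pn \<in> carrier_mat r r" unfolding Pn_def
    by (rule mult_carrier_mat[OF minus_carrier_mat[OF mult_carrier_mat[OF Kc G]] P])
  have J: "J \<in> carrier_mat r r" using Pinv G Xp(1) by (simp add: J_def)
  have "D * R * D \<in> carrier_mat N N" using D Rc by simp
  moreover have "Y * (G * P_pred * G\<^sup>T + D * R * D) = D" using Yp(3) by (simp only: S_eq)
  ultimately have PnX: "Pn * (G\<^sup>T * X) = K" and PnJ: "Pn * J = 1\<^sub>m r"
    unfolding Pn_def J_def K'
    by (rule kalman_information_identities
        [OF P Pinv PPinv G _ Xp(1) Yp(1) Xp(2) _ Yp(5) Xp(4)])+
  \<comment> \<open>\<open>PnJ\<close> gives a left inverse of \<open>J\<close>; for square matrices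
    the product may be reversed, which identifies \<open>Pn\<close> as
    \<open>mat_inv J\<close>.\<close>
  note J_inv = right_inverse_imp_mat_inv[OF J Pn mat_mult_left_right_inverse[OF Pn J PnJ]]
  have xp: "x_pred \<in> carrier_vec r" 
    unfolding x_pred by (rule mult_mat_vec_carrier[OF F_carrier x_kk])
  \<comment> \<open>The information form expands to \<open>Pn * Pinv\<close>, which is
    \<open>1\<^sub>m r - K * G\<close>, applied to \<open>x_pred\<close>, plus
    \<open>Pn * (G\<^sup>T * X) = K\<close> applied to \<open>zz\<close>.\<close>
  have state: "x_pred + K *\<^sub>v (zz - G *\<^sub>v x_pred)
      = Pn *\<^sub>v (Pinv *\<^sub>v x_pred + (G\<^sup>T * X) *\<^sub>v zz)"
  proof -
    have GX: "G\<^sup>T * X \<in> carrier_mat r N" using G Xp(1) by simp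
    have IK: "1\<^sub>m r - K * G \<in> carrier_mat r r" by (rule minus_carrier_mat[OF mult_carrier_mat[OF Kc G]])
    have Gx: "G *\<^sub>v x_pred \<in> carrier_vec N" using G xp by simp
    have "Pn *\<^sub>v (Pinv *\<^sub>v x_pred + (G\<^sup>T * X) *\<^sub>v zz)
        = Pn *\<^sub>v (Pinv *\<^sub>v x_pred) + Pn *\<^sub>v ((G\<^sup>T * X) *\<^sub>v zz)"
      using Pinv xp GX zz by (intro mult_add_distrib_mat_vec[OF Pn]) auto
    also have "Pn *\<^sub>v ((G\<^sup>T * X) *\<^sub>v zz) = K *\<^sub>v zz"
      using assoc_mult_mat_vec[OF Pn GX zz] by (simp add: PnX)
    also have "Pn *\<^sub>v (Pinv *\<^sub>v x_pred) = (1\<^sub>m r - K * G) *\<^sub>v x_pred"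
    proof -
      have "Pn * Pinv = 1\<^sub>m r - K * G"
        using G P Pinv right_mult_one_mat[OF IK] by (simp add: Pn_def mat_mult_assoc_dim PPinv)
      then show ?thesis using assoc_mult_mat_vec[OF Pn Pinv xp] by simp
    qed
    also have "\<dots> = x_pred - K *\<^sub>v (G *\<^sub>v x_pred)"
      using Kc G xp by (simp add: minus_mult_distrib_mat_vec[of _ r r] assoc_mult_mat_vec[of _ r N _ r])
    also have "x_pred - K *\<^sub>v (G *\<^sub>v x_pred) + K *\<^sub>v zz = x_pred + (K *\<^sub>v zz - K *\<^sub>v (G *\<^sub>v x_pred))"
      using Kc xp zz Gx by (intro eq_vecI) auto
    also have "\<dots> = x_pred + K *\<^sub>v (zz - G *\<^sub>v x_pred)"
      by (simp only: mult_minus_distrib_mat_vec[OF Kc zz Gx])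
    finally show ?thesis by (rule sym)
  qed
  \<comment> \<open>After rewriting, both sides contain \<open>P_new = Pn\<close>, and their state
    equations differ only in \<open>Pn\<close> against \<open>P_new\<close>.\<close>
  show ?thesis
    unfolding Rt G_def[symmetric] zz_def[symmetric] X_def[symmetric] P_inv(2) J_def[symmetric]
      J_inv(2) Pn_def[symmetric] state
    using P_inv(1) J_inv(1) by blast
qed

end
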